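(* Let $S$ be a numerical semigroup and $\theta$ an $\mathrm{i}$-pertinent map. Define $S_0=S$ and, for $n\in\mathbb{N}$, $S_{n+1}=S_n\cup\theta(S_n)$ if $S_n\neq\mathbb{N}$ and $S_{n+1}=\mathbb{N}$ otherwise. Then there exists $\mu(\theta,S)\in\mathbb{N}$ such that $S=S_0\subsetneq S_1\subsetneq\dots\subsetneq S_{\mu(\theta,S)}=\mathbb{N}$. Moreover, this chain is an $\mathrm{i}$-chain.
   Context: A numerical semigroup is a subset $S\subseteq\mathbb{N}$ containing $0$, closed under addition, with finite complement in $\mathbb{N}$. $\mathcal{L}$ denotes the set of all numerical semigroups. $\mathrm{PF}(S)$ is the set of integers $x\notin S$ with $x+s\in S$ for all $s\in S\setminus\{0\}$. A set $A$ is $\mathrm{i}(S)$-pertinent if $A\subseteq\mathrm{PF}(S)$ and, whenever $\{a,b\}\subseteq A$ and $a+b\in\mathrm{PF}(S)$, then $a+b\in A$. A map $\theta:\mathcal{L}\setminus\{\mathbb{N}\}\to\mathscr{P}(\mathbb{N})$ is $\mathrm{i}$-pertinent if $\theta(S)$ is a nonempty $\mathrm{i}(S)$-pertinent set for every $S\in\mathcal{L}\setminus\{\mathbb{N}\}$. An ideal of a numerical semigroup $\Delta$ is a nonempty $I\subseteq\Delta$ with $I+\Delta\subseteq I$; $\mathcal{J}(\Delta)$ is the set of numerical semigroups $T$ with $T\setminus\{0\}$ an ideal of $\Delta$. An $\mathrm{i}$-chain of length $n$ is a chain of numerical semigroups $S_0\subseteq\dots\subseteq S_n$ with $S_i\in\mathcal{J}(S_{i+1})$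 for all $i\in\{0,\dots,n-1\}$. *)

theory Defs
  imports Main
begin

definition numerical_semigroup :: "nat set \<Rightarrow> bool" where
  "numerical_semigroup S \<longleftrightarrow>
     0 \<in> S \<and> (\<forall>x\<in>S. \<forall>y\<in>S. x + y \<in> S) \<and> finite (- S)"

text \<open>
  Pseudo-Frobenius numbers are integers, not just naturals: for instance
  \<open>PF UNIV = {- 1}\<close>.
\<close>

definition PF :: "nat set \<Rightarrow> int set" where
  "PF S = {x. x \<notin> int ` S \<and> (\<forall>s\<in>S - {0}. x + int s \<in> int ` S)}"

definition i_pertinent :: "nat set \<Rightarrow> int set \<Rightarrow> bool" where
  "i_pertinent S A \<longleftrightarrow>
     A \<subseteq> PF S \<and> (\<forall>a\<in>A. \<forall>b\<in>A. a + b \<in> PF S \<longrightarrow> a + b \<in> A)"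

text \<open>
  A map on the numerical semigroups other than \<open>UNIV\<close> is modelled by a total function
  whose values at all other sets are unconstrained.
\<close>

definition i_pertinent_map :: "(nat set \<Rightarrow> nat set) \<Rightarrow> bool" where
  "i_pertinent_map \<theta> \<longleftrightarrow>
     (\<forall>S. numerical_semigroup S \<and> S \<noteq> UNIV \<longrightarrow>
        \<theta> S \<noteq> {} \<and> i_pertinent S (int ` \<theta> S))"

definition semigroup_ideal :: "nat set \<Rightarrow> nat set \<Rightarrow> bool" where
  "semigroup_ideal I \<Delta> \<longleftrightarrow>
     I \<noteq> {} \<and> I \<subseteq> \<Delta> \<and> (\<forall>x\<in>I. \<forall>d\<in>\<Delta>. x + d \<in> I)"

definition ideal_semigroups :: "nat set \<Rightarrow> nat set set" where
  "ideal_semigroups \<Delta> = {T. numerical_semigroup T \<and> semigroup_ideal (T - {0}) \<Delta>}"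

text \<open>
  A chain of length \<open>n\<close> has the \<open>n + 1\<close> members \<open>C 0, \<dots>, C n\<close>;
  the values of \<open>C\<close> beyond \<open>n\<close> are irrelevant.
\<close>

definition i_chain :: "nat \<Rightarrow> (nat \<Rightarrow> nat set) \<Rightarrow> bool" where
  "i_chain n C \<longleftrightarrow>
     (\<forall>i\<le>n. numerical_semigroup (C i)) \<and>
     (\<forall>i<n. C i \<subseteq> C (Suc i)) \<and>
     (\<forall>i<n. C i \<in> ideal_semigroups (C (Suc i)))"

primrec theta_seq :: "(nat set \<Rightarrow> nat set) \<Rightarrow> nat set \<Rightarrow> nat \<Rightarrow> nat set" where
  "theta_seq \<theta> S 0 = S"
| "theta_seq \<theta> S (Suc n) =
     (if theta_seq \<theta> S n \<noteq> UNIV then theta_seq \<theta> S n \<union> \<theta> (theta_seq \<theta> S n) else UNIV)"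

end

theory Submission
  imports Defs
begin

text \<open>
  If \<open>a\<close>, \<open>b\<close> are pseudo-Frobenius numbers of \<open>S\<close> and \<open>0 \<noteq> s \<in> S\<close>, then \<open>a + b + s = a + (b + s)\<close>
  lies in \<open>S\<close>, so \<open>a + b\<close> is either in \<open>S\<close> or again pseudo-Frobenius. Hence adjoining a pertinent
  set to \<open>S\<close> gives a numerical semigroup in which \<open>S - {0}\<close> is an ideal. Each step fills at least
  one of the finitely many gaps of \<open>S\<close>, so the sequence reaches \<open>\<nat>\<close>.
\<close>

text \<open>\<open>PF\<close> lives in the integers while the values of \<open>\<theta>\<close> are
  sets of naturals; injectivity of \<open>int\<close> brings every later argument back to
  \<open>nat\<close>.\<close>

lemma int_mem_PF_iff: "int a \<in> PF S \<longleftrightarrow> a \<notin> S \<and> (\<forall>s\<in>S - {0}. a + s \<in> S)"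
  by (auto simp: PF_def inj_image_mem_iff simp flip: of_nat_add)

lemma i_pertinent_not_mem:
  assumes "i_pertinent S (int ` A)" and "a \<in> A"
  shows "a \<notin> S"
  using assms by (auto simp: i_pertinent_def int_mem_PF_iff image_subset_iff)

lemma i_pertinent_add_mem:
  assumes "i_pertinent S (int ` A)" and "a \<in> A" and "s \<in> S" and "s \<noteq> 0"
  shows "a + s \<in> S"
  using assms by (auto simp: i_pertinent_def int_mem_PF_iff image_subset_iff)

lemma i_pertinent_add_closed:
  assumes "i_pertinent S (int ` A)" and "a \<in> A" and "b \<in> A"
  shows "a + b \<in> S \<union> A"
proof (cases "a + b \<in> S")
  case False
  have "a + b + s \<in> S" if "s \<in> S" "s \<noteq> 0" for s
    \<comment> \<open>Absorb \<open>s\<close> into \<open>b\<close> first: \<open>b + s\<close> lies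
      in \<open>S\<close> and is nonzero because \<open>s\<close> is, so \<open>a\<close> can be
      added to it.\<close>
    using i_pertinent_add_mem[OF assms(1,2), of "b + s"] i_pertinent_add_mem[OF assms(1,3) that] that
    by (simp add: add.assoc)
  with False have "int (a + b) \<in> PF S"
    by (simp add: int_mem_PF_iff del: of_nat_add)
  then have "int (a + b) \<in> int ` A"
    using assms by (simp add: i_pertinent_def)
  then show ?thesis
    by (simp add: inj_image_mem_iff del: of_nat_add)
qed simp

lemma numerical_semigroup_Un_i_pertinent:
  assumes "numerical_semigroup S" and "i_pertinent S (int ` A)"
  shows "numerical_semigroup (S \<union> A)"
  unfolding numerical_semigroup_def
proof (intro conjI ballI)
  show "0 \<in> S \<union> A" and "finite (- (S \<union> A))"
    using assms(1) by (auto simp: numerical_semigroup_def)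
  have mixed: "a + s \<in> S \<union> A" if "a \<in> A" "s \<in> S" for a s
    \<comment> \<open>The pseudo-Frobenius condition covers only nonzero \<open>s\<close>; for
      \<open>s = 0\<close> the sum is \<open>a\<close> itself, a member of \<open>A\<close>.\<close>
    using i_pertinent_add_mem[OF assms(2) that] that by (cases "s = 0") auto
  show "x + y \<in> S \<union> A" if "x \<in> S \<union> A" "y \<in> S \<union> A" for x y
    using that mixed[of x y] mixed[of y x] i_pertinent_add_closed[OF assms(2), of x y] assms(1)
    by (auto simp: numerical_semigroup_def add.commute)
qed

lemma mem_ideal_semigroups_Un_i_pertinent:
  assumes "numerical_semigroup S" and "i_pertinent S (int ` A)"
  shows "S \<in> ideal_semigroups (S \<union> A)"
proof -
  \<comment> \<open>An ideal has to be nonempty: a cofinite set of naturals is infinite, so it keeps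
    an element when 0 is removed.\<close>
  have "infinite S"
    using assms(1) finite_compl[of S] by (auto simp: numerical_semigroup_def)
  then have "S - {0} \<noteq> {}"
    by (metis finite.emptyI finite_Diff2 finite.insertI)
  moreover have "x + d \<in> S - {0}" if "x \<in> S - {0}" "d \<in> S \<union> A" for x d
    using that assms(1) i_pertinent_add_mem[OF assms(2), of d x]
    by (auto simp: numerical_semigroup_def add.commute)
  ultimately show ?thesis
    using assms(1) unfolding ideal_semigroups_def semigroup_ideal_def by blast
qed

lemma numerical_semigroup_theta_seq:
  assumes "numerical_semigroup S" and "i_pertinent_map \<theta>"
  shows "numerical_semigroup (theta_seq \<theta> S n)"
proof (induction n)
  case (Suc n)
  show ?case
  proof (cases "theta_seq \<theta> S n = UNIV")
    case False
    then show ?thesis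
      using Suc assms(2) by (simp add: i_pertinent_map_def numerical_semigroup_Un_i_pertinent)
  qed (simp add: numerical_semigroup_def)
qed (use assms in simp)

text \<open>Strictness combines nonemptiness of \<open>\<theta>\<close> with the fact that
  pseudo-Frobenius numbers are gaps.\<close>

lemma theta_seq_psubset_Suc:
  assumes "numerical_semigroup S" and "i_pertinent_map \<theta>" and "theta_seq \<theta> S n \<noteq> UNIV"
  shows "theta_seq \<theta> S n \<subset> theta_seq \<theta> S (Suc n)"
proof -
  let ?T = "theta_seq \<theta> S n"
  have "\<theta> ?T \<noteq> {}" and "i_pertinent ?T (int ` \<theta> ?T)"
    using assms numerical_semigroup_theta_seq[OF assms(1,2)] by (auto simp: i_pertinent_map_def)
  then show ?thesis
    using assms(3) i_pertinent_not_mem[of ?T "\<theta> ?T"] by auto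
qed

lemma theta_seq_mem_ideal_semigroups:
  assumes "numerical_semigroup S" and "i_pertinent_map \<theta>" and "theta_seq \<theta> S n \<noteq> UNIV"
  shows "theta_seq \<theta> S n \<in> ideal_semigroups (theta_seq \<theta> S (Suc n))"
  using assms numerical_semigroup_theta_seq[OF assms(1,2)]
  by (simp add: i_pertinent_map_def mem_ideal_semigroups_Un_i_pertinent)

lemma theta_seq_eventually_UNIV:
  assumes "numerical_semigroup S" and "i_pertinent_map \<theta>"
  shows "\<exists>n. theta_seq \<theta> S n = UNIV"
proof (rule ccontr)
  assume "\<nexists>n. theta_seq \<theta> S n = UNIV"
  then have "card (- theta_seq \<theta> S (Suc n)) < card (- theta_seq \<theta> S n)" for n
    using theta_seq_psubset_Suc[OF assms, of n] numerical_semigroup_theta_seq[OF assms, of n]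
    by (intro psubset_card_mono) (auto simp: numerical_semigroup_def)
  \<comment> \<open>Otherwise the gap sets would descend forever in the well-founded order by
    cardinality.\<close>
  then show False
    using wf_no_infinite_down_chainE[OF wf_measure[of card], of "\<lambda>n. - theta_seq \<theta> S n"]
    by auto
qed

theorem theorem14:
  fixes S :: "nat set" and \<theta> :: "nat set \<Rightarrow> nat set"
  assumes "numerical_semigroup S"
    and "i_pertinent_map \<theta>"
  shows "\<exists>\<mu>. theta_seq \<theta> S 0 = S \<and>
              (\<forall>i<\<mu>. theta_seq \<theta> S i \<subset> theta_seq \<theta> S (Suc i)) \<and>
              theta_seq \<theta> S \<mu> = UNIV \<and>
              i_chain \<mu> (theta_seq \<theta> S)"
proof -
  \<comment> \<open>Taking the least such index keeps all earlier terms different from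
    \<open>UNIV\<close>, so every step before \<open>\<mu>\<close> is a proper extension.\<close>
  define \<mu> where "\<mu> = (LEAST n. theta_seq \<theta> S n = UNIV)"
  have top: "theta_seq \<theta> S \<mu> = UNIV"
    unfolding \<mu>_def using theta_seq_eventually_UNIV[OF assms] by (rule LeastI_ex)
  have "theta_seq \<theta> S i \<noteq> UNIV" if "i < \<mu>" for i
    using that not_less_Least unfolding \<mu>_def by blast
  note below = theta_seq_psubset_Suc[OF assms this] theta_seq_mem_ideal_semigroups[OF assms this]
  have "i_chain \<mu> (theta_seq \<theta> S)"
    unfolding i_chain_def
    using below numerical_semigroup_theta_seq[OF assms] by blast
  with top below(1) show ?thesis
    by (intro exI[of _ \<mu>]) (simp del: theta_seq.simps(2))
qed

end
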